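(* Let $G$ be a linear algebraic group over an infinite field $\Bbbk$ and let $p=\operatorname{char}(\Bbbk)$. For any $G$-module $V$, the quantity $\delta(G,V)$ is zero, one, or a power of $p$.
   Context: $\Bbbk$ is an infinite field of any characteristic and $G$ is a linear algebraic group over $\Bbbk$. A $G$-module is a finite dimensional $\Bbbk$-vector space $V$ on which $G$ acts linearly and rationally. $V^G$ denotes the set of $v\in V$ fixed by all of $G$. $\Bbbk[V]=S(V^* )$ is the ring of polynomial functions $V\to\Bbbk$ (the symmetric algebra of the dual of $V$), graded by total degree, $\Bbbk[V]=\bigoplus_{d\ge 0}\Bbbk[V]_d$. $G$ acts on $\Bbbk[V]$ by $g(f):=f\circ g^{-1}$ for $g\in G$, $f\in\Bbbk[V]$, and this action preserves the grading. $\Bbbk[V]^G$ is the ring of invariants (the polynomials fixed by this action), and $\Bbbk[V]^G_d$ is its degree-$d$ homogeneous component. For $v\in V$, $$\epsilon(G,v):=\inf\{d\in\mathbb{N}_{>0}\mid \text{there exists } f\in\Bbbk[V]^G_d \text{ such that } f(v)\neq 0\},$$ where the infimum of the empty set is $\infty$. Hilbert's nullcone $\mathcal{N}_{G,V}\subseteq V$ is the common vanishing set of all homogeneous invariants in $\Bbbk[V]^G$ of positive degree. Define $$\delta(G,V):=\sup\left(\{\epsilon(G,v)\mid v\in V^G\setminus\mathcal{N}_{G,V}\}\cup\{0\}\right).$$ *)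

theory Defs
  imports "HOL-Analysis.Determinants" "HOL-Library.Extended_Nat"
    "HOL-Computational_Algebra.Polynomial"
begin

inductive_set generated_algebra :: "('x \<Rightarrow> 'k::comm_ring_1) set \<Rightarrow> ('x \<Rightarrow> 'k) set"
  for S where
  const: "(\<lambda>x. c) \<in> generated_algebra S"
| gen: "f \<in> S \<Longrightarrow> f \<in> generated_algebra S"
| add: "f \<in> generated_algebra S \<Longrightarrow> g \<in> generated_algebra S \<Longrightarrow>
    (\<lambda>x. f x + g x) \<in> generated_algebra S"
| mult: "f \<in> generated_algebra S \<Longrightarrow> g \<in> generated_algebra S \<Longrightarrow>
    (\<lambda>x. f x * g x) \<in> generated_algebra S"


subsection \<open>Linear algebraic groups\<close>

definition matrix_entries :: "('k::field^'n^'n \<Rightarrow> 'k) set" where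
  "matrix_entries = {(\<lambda>A. A $ i $ j) | i j. True}"

text \<open>
  The coordinate ring of the general linear group: polynomials in the matrix entries and the
  inverse determinant. Its elements are only ever evaluated at invertible matrices.
\<close>

definition GL_regular_functions :: "('k::field^'n^'n \<Rightarrow> 'k) set" where
  "GL_regular_functions = generated_algebra (matrix_entries \<union> {\<lambda>A. inverse (det A)})"

text \<open>
  A linear algebraic group is a Zariski closed subgroup of some general linear group over the
  base field, identified with its group of rational points.
\<close>

definition linear_algebraic_group :: "('k::field^'n^'n) set \<Rightarrow> bool" where
  "linear_algebraic_group G \<longleftrightarrow>
     (\<exists>P \<subseteq> generated_algebra matrix_entries. G = {A. invertible A \<and> (\<forall>f\<in>P. f A = 0)}) \<and>
     mat 1 \<in> G \<and>
     (\<forall>A\<in>G. \<forall>B\<in>G. A ** B \<in> G) \<and>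
     (\<forall>A\<in>G. matrix_inv A \<in> G)"


subsection \<open>Modules\<close>

definition linear_functionals :: "('k::field \<Rightarrow> 'v::ab_group_add \<Rightarrow> 'v) \<Rightarrow> ('v \<Rightarrow> 'k) set" where
  "linear_functionals smul = {l. Vector_Spaces.linear smul (*) l}"

text \<open>
  The last conjunct is rationality of the representation: all its matrix coefficients are
  regular functions on the group.
\<close>

definition G_module ::
  "('k::field^'n^'n) set \<Rightarrow> ('k \<Rightarrow> 'v::ab_group_add \<Rightarrow> 'v) \<Rightarrow> ('k^'n^'n \<Rightarrow> 'v \<Rightarrow> 'v) \<Rightarrow> bool" where
  "G_module G smul \<rho> \<longleftrightarrow>
     (\<exists>B. finite_dimensional_vector_space smul B) \<and>
     (\<forall>A\<in>G. Vector_Spaces.linear smul smul (\<rho> A)) \<and>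
     (\<forall>v. \<rho> (mat 1) v = v) \<and>
     (\<forall>A\<in>G. \<forall>B\<in>G. \<forall>v. \<rho> (A ** B) v = \<rho> A (\<rho> B v)) \<and>
     (\<forall>v. \<forall>l\<in>linear_functionals smul.
        \<exists>f\<in>GL_regular_functions. \<forall>A\<in>G. l (\<rho> A v) = f A)"

definition fixed_points ::
  "('k::field^'n^'n) set \<Rightarrow> ('k^'n^'n \<Rightarrow> 'v \<Rightarrow> 'v) \<Rightarrow> 'v set" where
  "fixed_points G \<rho> = {v. \<forall>A\<in>G. \<rho> A v = v}"


subsection \<open>Polynomial functions and invariants\<close>

text \<open>
  Over an infinite field the symmetric algebra of the dual space is the same as the ring of
  polynomial functions, and its component of degree \<open>d\<close> consists of the linear combinations
  of \<open>d\<close>-fold products of linear functionals.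
\<close>

definition polynomial_functions ::
  "('k::field \<Rightarrow> 'v::ab_group_add \<Rightarrow> 'v) \<Rightarrow> ('v \<Rightarrow> 'k) set" where
  "polynomial_functions smul = generated_algebra (linear_functionals smul)"

definition homogeneous_functions ::
  "('k::field \<Rightarrow> 'v::ab_group_add \<Rightarrow> 'v) \<Rightarrow> nat \<Rightarrow> ('v \<Rightarrow> 'k) set" where
  "homogeneous_functions smul d =
     {(\<lambda>v. \<Sum>i<m. c i * (\<Prod>j<d. l i j v)) | (m::nat) c l.
        \<forall>i<m. \<forall>j<d. l i j \<in> linear_functionals smul}"

definition act_fun ::
  "('k::field^'n^'n \<Rightarrow> 'v \<Rightarrow> 'v) \<Rightarrow> 'k^'n^'n \<Rightarrow> ('v \<Rightarrow> 'k) \<Rightarrow> ('v \<Rightarrow> 'k)" where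
  "act_fun \<rho> A f = f \<circ> \<rho> (matrix_inv A)"

definition invariants ::
  "('k::field^'n^'n) set \<Rightarrow> ('k \<Rightarrow> 'v::ab_group_add \<Rightarrow> 'v) \<Rightarrow> ('k^'n^'n \<Rightarrow> 'v \<Rightarrow> 'v) \<Rightarrow>
     ('v \<Rightarrow> 'k) set" where
  "invariants G smul \<rho> = {f \<in> polynomial_functions smul. \<forall>A\<in>G. act_fun \<rho> A f = f}"

definition homogeneous_invariants ::
  "('k::field^'n^'n) set \<Rightarrow> ('k \<Rightarrow> 'v::ab_group_add \<Rightarrow> 'v) \<Rightarrow> ('k^'n^'n \<Rightarrow> 'v \<Rightarrow> 'v) \<Rightarrow>
     nat \<Rightarrow> ('v \<Rightarrow> 'k) set" where
  "homogeneous_invariants G smul \<rho> d = invariants G smul \<rho> \<inter> homogeneous_functions smul d"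

definition nullcone ::
  "('k::field^'n^'n) set \<Rightarrow> ('k \<Rightarrow> 'v::ab_group_add \<Rightarrow> 'v) \<Rightarrow> ('k^'n^'n \<Rightarrow> 'v \<Rightarrow> 'v) \<Rightarrow> 'v set" where
  "nullcone G smul \<rho> = {v. \<forall>d>0. \<forall>f\<in>homogeneous_invariants G smul \<rho> d. f v = 0}"

definition epsilon ::
  "('k::field^'n^'n) set \<Rightarrow> ('k \<Rightarrow> 'v::ab_group_add \<Rightarrow> 'v) \<Rightarrow> ('k^'n^'n \<Rightarrow> 'v \<Rightarrow> 'v) \<Rightarrow>
     'v \<Rightarrow> enat" where
  "epsilon G smul \<rho> v =
     Inf {enat d | d. d > 0 \<and> (\<exists>f\<in>homogeneous_invariants G smul \<rho> d. f v \<noteq> 0)}"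

definition delta ::
  "('k::field^'n^'n) set \<Rightarrow> ('k \<Rightarrow> 'v::ab_group_add \<Rightarrow> 'v) \<Rightarrow> ('k^'n^'n \<Rightarrow> 'v \<Rightarrow> 'v) \<Rightarrow> enat" where
  "delta G smul \<rho> =
     Sup ({epsilon G smul \<rho> v | v. v \<in> fixed_points G \<rho> - nullcone G smul \<rho>} \<union> {0})"

end

theory Submission
  imports Defs "HOL-Algebra.Exponent"
begin

text \<open>
  The proof is a polarisation argument. If \<open>f\<close> is an invariant, homogeneous of degree \<open>d\<close>, and
  \<open>w\<close> is a fixed point, expand \<open>f (x + t w) = (\<Sum>i\<le>d. F\<^sub>i(x) t\<^sup>i)\<close>. Translation by \<open>t w\<close> commutes
  with the group, so over an infinite field, where the coefficients of a polynomial in \<open>t\<close> are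
  determined by its values, every \<open>F\<^sub>i\<close> is an invariant, homogeneous of degree \<open>d - i\<close>. This is
  lemma \<open>polarization\<close>; it is used twice.

  For \<open>w = x = v\<close>, comparison with \<open>f (v + t v) = (1 + t)\<^sup>d f(v)\<close> gives \<open>F\<^sub>i(v) = (d choose i) f(v)\<close>.
  Let \<open>q\<close> be the largest power of the characteristic dividing \<open>d\<close> (or \<open>1\<close> in characteristic zero).
  Then \<open>d choose q\<close> is nonzero in the field, so if \<open>f\<close> does not vanish at \<open>v\<close>, then neither does the
  invariant \<open>F\<^sub>i\<close> of degree \<open>d - i = q\<close>. Hence the least positive degree of an invariant not vanishing
  at a given fixed point is a power of the characteristic or \<open>1\<close> (lemma \<open>epsilon_CHAR_power\<close>).

  It remains to see that the supremum is attained, that is, that these least degrees are bounded.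
  Let \<open>W\<^sub>d\<close> be the set of fixed points at which all invariants of degrees \<open>1, \<dots>, d\<close> vanish.
  Polarisation at a point \<open>w \<in> W\<^sub>d\<close> shows that \<open>W\<^sub>d\<close> is closed under addition: in the
  expansion of \<open>f (v + w)\<close> for an invariant \<open>f\<close> of degree \<open>e \<le> d\<close> the terms \<open>F\<^sub>i(v)\<close> with \<open>i < e\<close> vanish
  because \<open>v \<in> W\<^sub>d\<close>, and \<open>F\<^sub>e\<close> is a constant function, with value \<open>f(w) = 0\<close>.
  So the \<open>W\<^sub>d\<close> form a decreasing chain of linear subspaces of a finite dimensional space, which is
  stationary from some \<open>D\<close> on, and \<open>D\<close> bounds the degrees in question.
\<close>

section \<open>Binomial coefficients and polynomial identities over a field\<close>

text \<open>
  In positive characteristic \<open>p\<close> the exponent to take is that of \<open>p\<close> in \<open>d\<close>: the binomial coefficient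
  of \<open>p\<^sup>n m\<close> and \<open>p\<^sup>n\<close> contains \<open>p\<close> exactly as often as \<open>m\<close> does. In characteristic zero
  \<open>n = 0\<close> works because \<open>d choose 1 = d\<close>; there the bound \<open>0 < CHAR('k) ^ n\<close> says precisely that
  \<open>n = 0\<close>, since \<open>CHAR('k) = 0\<close>.
\<close>

lemma ex_CHAR_power_binomial_nonzero:
  fixes d :: nat
  assumes "d > 0"
  shows "\<exists>n. 0 < CHAR('k::field) ^ n \<and> CHAR('k) ^ n \<le> d \<and> of_nat (d choose (CHAR('k) ^ n)) \<noteq> (0::'k)"
proof (cases "CHAR('k) = 0")
  case True
  then show ?thesis using assms by (intro exI[of _ 0]) (auto simp: of_nat_eq_0_iff_char_dvd)
next
  case False
  then have p: "prime CHAR('k)" by (simp add: prime_CHAR_semidom)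
  define n where "n = multiplicity CHAR('k) d"
  obtain m where m: "d = CHAR('k) ^ n * m" "\<not> CHAR('k) dvd m"
    using multiplicity_decompose'[of d "CHAR('k)"] assms p unfolding n_def
    by (metis bot_nat_0.not_eq_extremum not_prime_unit)
  have m0: "m > 0" using m assms by (cases m) auto
  have "multiplicity CHAR('k) (d choose (CHAR('k) ^ n)) = 0"
    using const_p_fac[OF m0 p, of n] m by (simp add: not_dvd_imp_multiplicity_0)
  moreover have le: "CHAR('k) ^ n \<le> d" using m(1) m0 by simp
  ultimately have "\<not> CHAR('k) dvd (d choose (CHAR('k) ^ n))"
    using p by (metis binomial_eq_0_iff multiplicity_eq_zero_iff not_le not_prime_unit)
  then show ?thesis using le False by (auto simp: of_nat_eq_0_iff_char_dvd)
qed

lemma polynomial_coefficients_unique: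
  fixes a b :: "nat \<Rightarrow> 'k::field"
  assumes inf: "infinite (UNIV :: 'k set)"
    and eq: "\<And>t. (\<Sum>i\<le>d. a i * t ^ i) = (\<Sum>i\<le>d. b i * t ^ i)" and "i \<le> d"
  shows "a i = b i"
proof -
  define P where "P = (\<Sum>i\<le>d. monom (a i - b i) i)"
  have "poly P t = 0" for t
    using eq[of t] by (simp add: P_def poly_sum poly_monom left_diff_distrib sum_subtractf)
  then have "P = 0" using poly_roots_finite[of P] inf by auto
  moreover have "coeff P i = a i - b i"
    using \<open>i \<le> d\<close> by (simp add: P_def coeff_sum)
  ultimately show ?thesis by simp
qed

section \<open>Homogeneous polynomial functions\<close>

lemma linear_functional_add:
  "l \<in> linear_functionals smul \<Longrightarrow> l (x + y) = l x + l y"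
  by (auto simp: linear_functionals_def Vector_Spaces.linear_iff)

lemma linear_functional_scale:
  "l \<in> linear_functionals smul \<Longrightarrow> l (smul c x) = c * l x"
  by (auto simp: linear_functionals_def Vector_Spaces.linear_iff)

lemma homogeneous_functionE:
  assumes "f \<in> homogeneous_functions smul d"
  obtains m :: nat and c l where "f = (\<lambda>v. \<Sum>i<m. c i * (\<Prod>j<d. l i j v))"
    and "\<And>i j. i < m \<Longrightarrow> j < d \<Longrightarrow> l i j \<in> linear_functionals smul"
  using assms unfolding homogeneous_functions_def by blast

text \<open>
  Lets terms and factors be indexed by arbitrary finite sets, so that the terms of an expanded
  product can be indexed by sets of factors.
\<close>

lemma sum_of_products_homogeneous:
  assumes "finite A" and J: "\<And>a. a \<in> A \<Longrightarrow> finite (J a) \<and> card (J a) = d"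
    and l: "\<And>a j. a \<in> A \<Longrightarrow> j \<in> J a \<Longrightarrow> l a j \<in> linear_functionals smul"
  shows "(\<lambda>v. \<Sum>a\<in>A. c a * (\<Prod>j\<in>J a. l a j v)) \<in> homogeneous_functions smul d"
proof -
  obtain h where h: "bij_betw h {..<card A} A"
    using ex_bij_betw_nat_finite[OF \<open>finite A\<close>] by (auto simp: lessThan_atLeast0)
  have "\<exists>g. bij_betw g {..<d} (J a)" if "a \<in> A" for a
    using ex_bij_betw_nat_finite[of "J a"] J[OF that] by (auto simp: lessThan_atLeast0)
  then obtain g where g: "\<And>a. a \<in> A \<Longrightarrow> bij_betw (g a) {..<d} (J a)" by metis
  have "(\<Sum>a\<in>A. c a * (\<Prod>j\<in>J a. l a j v)) =
      (\<Sum>i<card A. c (h i) * (\<Prod>j<d. l (h i) (g (h i) j) v))" for v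
  proof -
    have "(\<Sum>a\<in>A. c a * (\<Prod>j\<in>J a. l a j v)) = (\<Sum>a\<in>A. c a * (\<Prod>j<d. l a (g a j) v))"
      by (intro sum.cong refl arg_cong2[where f = "(*)"] prod.reindex_bij_betw[symmetric] g)
    also have "\<dots> = (\<Sum>i<card A. c (h i) * (\<Prod>j<d. l (h i) (g (h i) j) v))"
      by (rule sum.reindex_bij_betw[OF h, symmetric])
    finally show ?thesis .
  qed
  moreover have "l (h i) (g (h i) j) \<in> linear_functionals smul" if "i < card A" "j < d" for i j
    using that h g l by (meson bij_betwE lessThan_iff)
  ultimately show ?thesis
    unfolding homogeneous_functions_def
    by (intro CollectI exI[of _ "card A"] exI[of _ "\<lambda>i. c (h i)"]
        exI[of _ "\<lambda>i j. l (h i) (g (h i) j)"]) auto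
qed

lemma homogeneous_functions_polynomial:
  assumes "f \<in> homogeneous_functions smul d"
  shows "f \<in> polynomial_functions smul"
proof -
  obtain m :: nat and c l where f: "f = (\<lambda>v. \<Sum>i<m. c i * (\<Prod>j<d. l i j v))"
    and l: "\<And>i j. i < m \<Longrightarrow> j < d \<Longrightarrow> l i j \<in> linear_functionals smul"
    using homogeneous_functionE[OF assms] by blast
  have prod: "(\<lambda>v. \<Prod>j<e. l i j v) \<in> polynomial_functions smul" if "i < m" "e \<le> d" for i e
    using that(2)
  proof (induction e)
    case (Suc e)
    then have "l i e \<in> polynomial_functions smul"
      using l[of i e] that(1) by (simp add: polynomial_functions_def generated_algebra.gen)
    with Suc show ?case unfolding polynomial_functions_def
      by (simp add: generated_algebra.mult)
  qed (simp add: polynomial_functions_def generated_algebra.const)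
  have "(\<lambda>v. \<Sum>i<k. c i * (\<Prod>j<d. l i j v)) \<in> polynomial_functions smul" if "k \<le> m" for k
    using that
  proof (induction k)
    case (Suc k)
    then show ?case using prod[of k d] unfolding polynomial_functions_def
      by (simp add: generated_algebra.add generated_algebra.mult generated_algebra.const)
  qed (simp add: polynomial_functions_def generated_algebra.const)
  then show ?thesis using f by simp
qed

lemma homogeneous_function_scale:
  assumes "f \<in> homogeneous_functions smul d"
  shows "f (smul t v) = t ^ d * f v"
proof -
  obtain m :: nat and c l where f: "f = (\<lambda>v. \<Sum>i<m. c i * (\<Prod>j<d. l i j v))"
    and l: "\<And>i j. i < m \<Longrightarrow> j < d \<Longrightarrow> l i j \<in> linear_functionals smul"
    using homogeneous_functionE[OF assms] by blast
  have "(\<Prod>j<d. l i j (smul t v)) = t ^ d * (\<Prod>j<d. l i j v)" if "i < m" for i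
    using l[OF that] by (simp add: linear_functional_scale prod.distrib)
  then show ?thesis by (simp add: f sum_distrib_left algebra_simps)
qed

lemma homogeneous_function_0_const:
  "f \<in> homogeneous_functions smul 0 \<Longrightarrow> f x = f y"
  by (auto simp: homogeneous_functions_def)

text \<open>
  Expanding a product of factors \<open>l(x) + t l(w)\<close> indexes its terms by the set \<open>X\<close> of factors that
  contribute \<open>t l(w)\<close>; those with \<open>card X = e\<close> make up the coefficient of \<open>t\<^sup>e\<close>.
\<close>

lemma homogeneous_function_expansion:
  assumes "f \<in> homogeneous_functions smul d"
  shows "\<exists>F. (\<forall>e\<le>d. F e \<in> homogeneous_functions smul (d - e)) \<and>
             (\<forall>x t. f (x + smul t w) = (\<Sum>e\<le>d. F e x * t ^ e))"
proof -
  obtain m :: nat and c l where f: "f = (\<lambda>v. \<Sum>i<m. c i * (\<Prod>j<d. l i j v))"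
    and l: "\<And>i j. i < m \<Longrightarrow> j < d \<Longrightarrow> l i j \<in> linear_functionals smul"
    using homogeneous_functionE[OF assms] by blast
  define S where "S e = {X. X \<subseteq> {..<d} \<and> card X = e}" for e
  define F where "F e x = (\<Sum>(i, X)\<in>{..<m} \<times> S e.
      (c i * (\<Prod>j\<in>X. l i j w)) * (\<Prod>j\<in>{..<d} - X. l i j x))" for e x
  have fin: "finite (S e)" for e by (simp add: S_def)
  have "F e \<in> homogeneous_functions smul (d - e)" if "e \<le> d" for e
  proof -
    have "card ({..<d} - X) = d - e" if "X \<in> S e" for X
      using that finite_subset[of X "{..<d}"] by (auto simp: S_def card_Diff_subset)
    then show ?thesis
      unfolding F_def[abs_def] case_prod_beta
      using fin by (intro sum_of_products_homogeneous) (auto intro: l)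
  qed
  moreover have "f (x + smul t w) = (\<Sum>e\<le>d. F e x * t ^ e)" for x t
  proof -
    define T where "T i X = (\<Prod>j\<in>X. l i j w) * (\<Prod>j\<in>{..<d} - X. l i j x)" for i X
    have "(\<Prod>j<d. l i j (x + smul t w)) = (\<Sum>e\<le>d. (\<Sum>X\<in>S e. T i X) * t ^ e)" if "i < m" for i
    proof -
      have "(\<Prod>j<d. l i j (x + smul t w)) = (\<Prod>j<d. t * l i j w + l i j x)"
        using l[OF that] by (intro prod.cong)
          (auto simp: linear_functional_add[where smul = smul] linear_functional_scale add.commute)
      also have "\<dots> = (\<Sum>X\<in>Pow {..<d}. T i X * t ^ card X)"
        by (simp add: prod_add prod.distrib T_def mult_ac)
      also have "\<dots> = (\<Sum>e\<le>d. \<Sum>X\<in>{X\<in>Pow {..<d}. card X = e}. T i X * t ^ card X)"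
        by (intro sum.group[symmetric]) (auto dest: card_mono[rotated])
      also have "\<dots> = (\<Sum>e\<le>d. (\<Sum>X\<in>S e. T i X) * t ^ e)"
        by (intro sum.cong refl) (auto simp: S_def sum_distrib_right intro!: sum.cong)
      finally show ?thesis .
    qed
    then have "f (x + smul t w) = (\<Sum>i<m. \<Sum>e\<le>d. c i * ((\<Sum>X\<in>S e. T i X) * t ^ e))"
      by (simp add: f sum_distrib_left)
    also have "\<dots> = (\<Sum>e\<le>d. \<Sum>i<m. c i * ((\<Sum>X\<in>S e. T i X) * t ^ e))"
      by (rule sum.swap)
    also have "\<dots> = (\<Sum>e\<le>d. F e x * t ^ e)"
      by (intro sum.cong refl)
        (simp add: F_def T_def sum.cartesian_product[symmetric] sum_distrib_left
          sum_distrib_right mult_ac)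
    finally show ?thesis .
  qed
  ultimately show ?thesis by blast
qed

section \<open>Polarisation of invariants at a fixed point\<close>

locale module_over_infinite_field =
  fixes G :: "('k::field^'n^'n) set"
    and smul :: "'k \<Rightarrow> 'v::ab_group_add \<Rightarrow> 'v"
    and \<rho> :: "'k^'n^'n \<Rightarrow> 'v \<Rightarrow> 'v"
  assumes infinite_field: "infinite (UNIV :: 'k set)"
    and group: "linear_algebraic_group G"
    and G_mod: "G_module G smul \<rho>"
begin

lemma vector_space: "vector_space smul"
  using G_mod by (auto simp: G_module_def finite_dimensional_vector_space_def)

sublocale vector_space smul by (rule vector_space)

lemma inverse_closed: "A \<in> G \<Longrightarrow> matrix_inv A \<in> G"
  using group by (auto simp: linear_algebraic_group_def)

lemma action_linear: "A \<in> G \<Longrightarrow> Vector_Spaces.linear smul smul (\<rho> A)"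
  using G_mod by (auto simp: G_module_def)

lemma action_add: "A \<in> G \<Longrightarrow> \<rho> A (x + y) = \<rho> A x + \<rho> A y"
  using action_linear by (auto simp: Vector_Spaces.linear_iff)

lemma action_scale: "A \<in> G \<Longrightarrow> \<rho> A (smul c x) = smul c (\<rho> A x)"
  using action_linear by (auto simp: Vector_Spaces.linear_iff)

lemma homogeneous_invariant_iff:
  "f \<in> homogeneous_invariants G smul \<rho> d \<longleftrightarrow>
     f \<in> homogeneous_functions smul d \<and> (\<forall>A\<in>G. \<forall>x. f (\<rho> (matrix_inv A) x) = f x)"
  by (auto simp: homogeneous_invariants_def invariants_def act_fun_def fun_eq_iff
      dest: homogeneous_functions_polynomial)

lemma homogeneous_invariant_scale:
  "f \<in> homogeneous_invariants G smul \<rho> d \<Longrightarrow> f (smul t v) = t ^ d * f v"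
  using homogeneous_function_scale[of f smul d t v] by (simp add: homogeneous_invariant_iff)

lemma homogeneous_invariant_at_0:
  assumes "f \<in> homogeneous_invariants G smul \<rho> d" and "0 < d"
  shows "f 0 = 0"
proof -
  have "f (smul 0 0) = 0 ^ d * f 0" using assms(1) by (rule homogeneous_invariant_scale)
  then show ?thesis using \<open>0 < d\<close> by (simp add: zero_power)
qed

text \<open>
  A group element sends \<open>x + t w\<close> to \<open>\<rho> A x + t w\<close>, so invariance of \<open>f\<close> becomes an identity
  between two polynomials in \<open>t\<close>, and comparing coefficients gives the invariance of each \<open>F i\<close>.
\<close>

lemma polarization:
  assumes f: "f \<in> homogeneous_invariants G smul \<rho> d" and w: "w \<in> fixed_points G \<rho>"
  shows "\<exists>F. (\<forall>i\<le>d. F i \<in> homogeneous_invariants G smul \<rho> (d - i)) \<and>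
             (\<forall>x t. f (x + smul t w) = (\<Sum>i\<le>d. F i x * t ^ i))"
proof -
  obtain F where F: "\<And>i. i \<le> d \<Longrightarrow> F i \<in> homogeneous_functions smul (d - i)"
    and exp: "\<And>x t. f (x + smul t w) = (\<Sum>i\<le>d. F i x * t ^ i)"
    using homogeneous_function_expansion[of f smul d w] f unfolding homogeneous_invariant_iff by metis
  have "F i (\<rho> (matrix_inv A) x) = F i x" if A: "A \<in> G" and "i \<le> d" for A i x
  proof (rule polynomial_coefficients_unique[OF infinite_field _ \<open>i \<le> d\<close>])
    fix t
    have "\<rho> (matrix_inv A) (x + smul t w) = \<rho> (matrix_inv A) x + smul t w"
      using inverse_closed[OF A] w by (simp add: action_add action_scale fixed_points_def)
    then show "(\<Sum>i\<le>d. F i (\<rho> (matrix_inv A) x) * t ^ i) = (\<Sum>i\<le>d. F i x * t ^ i)"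
      using f A by (metis exp homogeneous_invariant_iff)
  qed
  then show ?thesis using F exp by (intro exI[of _ F]) (simp add: homogeneous_invariant_iff)
qed

section \<open>Least degrees at fixed points\<close>

text \<open>
  Polarising \<open>f\<close> at the point \<open>v\<close> itself expands \<open>f (v + t v) = (1 + t)\<^sup>d f(v)\<close>, so the values of
  the coefficients at \<open>v\<close> are binomial multiples of \<open>f(v)\<close>.
\<close>

lemma ex_invariant_of_CHAR_power_degree:
  assumes f: "f \<in> homogeneous_invariants G smul \<rho> d" and "f v \<noteq> 0" and "d > 0"
    and v: "v \<in> fixed_points G \<rho>"
  shows "\<exists>n g. 0 < CHAR('k) ^ n \<and> CHAR('k) ^ n \<le> d \<and>
           g \<in> homogeneous_invariants G smul \<rho> (CHAR('k) ^ n) \<and> g v \<noteq> 0"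
proof -
  obtain n where n: "0 < CHAR('k) ^ n" "CHAR('k) ^ n \<le> d"
    "of_nat (d choose (CHAR('k) ^ n)) \<noteq> (0::'k)"
    using ex_CHAR_power_binomial_nonzero[OF \<open>d > 0\<close>] by blast
  obtain F where F: "\<And>i. i \<le> d \<Longrightarrow> F i \<in> homogeneous_invariants G smul \<rho> (d - i)"
    and exp: "\<And>x t. f (x + smul t v) = (\<Sum>i\<le>d. F i x * t ^ i)"
    using polarization[OF f v] by metis
  let ?i = "d - CHAR('k) ^ n"
  have "F ?i v = of_nat (d choose ?i) * f v"
  proof (rule polynomial_coefficients_unique[OF infinite_field, where d = d and i = ?i
        and a = "\<lambda>i. F i v" and b = "\<lambda>i. of_nat (d choose i) * f v"])
    fix t
    have "(\<Sum>i\<le>d. F i v * t ^ i) = f (smul (t + 1) v)"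
      by (simp add: exp[symmetric] scale_left_distrib add.commute)
    also have "\<dots> = (t + 1) ^ d * f v"
      by (rule homogeneous_invariant_scale[OF f])
    also have "\<dots> = (\<Sum>i\<le>d. of_nat (d choose i) * f v * t ^ i)"
      by (simp add: binomial_ring sum_distrib_left mult_ac)
    finally show "(\<Sum>i\<le>d. F i v * t ^ i) = (\<Sum>i\<le>d. of_nat (d choose i) * f v * t ^ i)" .
  qed simp
  then have "F ?i v \<noteq> 0" using n \<open>f v \<noteq> 0\<close> by (simp add: binomial_symmetric[symmetric])
  then show ?thesis using F[of ?i] n by auto
qed

lemma epsilon_le:
  assumes "f \<in> homogeneous_invariants G smul \<rho> d" "f v \<noteq> 0" "d > 0"
  shows "epsilon G smul \<rho> v \<le> enat d"
  unfolding epsilon_def using assms by (intro Inf_lower) blast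

lemma epsilon_attained:
  assumes "v \<notin> nullcone G smul \<rho>"
  obtains d f where "epsilon G smul \<rho> v = enat d" "d > 0"
    "f \<in> homogeneous_invariants G smul \<rho> d" "f v \<noteq> 0"
proof -
  define E where
    "E = {enat d | d. d > 0 \<and> (\<exists>f\<in>homogeneous_invariants G smul \<rho> d. f v \<noteq> 0)}"
  obtain x where "x \<in> E" using assms unfolding nullcone_def E_def by blast
  then have "Inf E \<in> E"
    using LeastI[of "\<lambda>x. x \<in> E" x] by (auto simp: Inf_enat_def)
  moreover have "epsilon G smul \<rho> v = Inf E" by (simp add: epsilon_def E_def)
  ultimately have "epsilon G smul \<rho> v \<in> E" by simp
  then obtain d f where "epsilon G smul \<rho> v = enat d" "d > 0"
    "f \<in> homogeneous_invariants G smul \<rho> d" "f v \<noteq> 0"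
    unfolding E_def by blast
  then show thesis by (rule that)
qed

text \<open>
  An invariant of least degree \<open>d\<close> not vanishing at \<open>v\<close> yields one of degree \<open>CHAR('k) ^ n \<le> d\<close>, which
  by minimality can only be \<open>d\<close> itself.
\<close>

lemma epsilon_CHAR_power:
  assumes v: "v \<in> fixed_points G \<rho>" and "v \<notin> nullcone G smul \<rho>"
  shows "\<exists>n. epsilon G smul \<rho> v = enat (CHAR('k) ^ n)"
proof -
  obtain d f where d: "epsilon G smul \<rho> v = enat d" "d > 0"
    and f: "f \<in> homogeneous_invariants G smul \<rho> d" "f v \<noteq> 0"
    using epsilon_attained[OF assms(2)] .
  obtain n g where n: "0 < CHAR('k) ^ n" "CHAR('k) ^ n \<le> d"
    and g: "g \<in> homogeneous_invariants G smul \<rho> (CHAR('k) ^ n)" "g v \<noteq> 0"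
    using ex_invariant_of_CHAR_power_degree[OF f d(2) v] by blast
  have "d \<le> CHAR('k) ^ n" using epsilon_le[OF g n(1)] d(1) by simp
  then have "d = CHAR('k) ^ n" using n by simp
  then show ?thesis using d(1) by blast
qed

section \<open>Boundedness of the least degrees\<close>

definition vanishing_fixed_points :: "nat \<Rightarrow> 'v set" where
  "vanishing_fixed_points d = {v \<in> fixed_points G \<rho>.
     \<forall>e f. 0 < e \<longrightarrow> e \<le> d \<longrightarrow> f \<in> homogeneous_invariants G smul \<rho> e \<longrightarrow> f v = 0}"

lemma vanishing_fixed_points_antimono:
  "d \<le> e \<Longrightarrow> vanishing_fixed_points e \<subseteq> vanishing_fixed_points d"
  by (auto simp: vanishing_fixed_points_def)

lemma vanishing_fixed_pointsD:
  assumes "v \<in> vanishing_fixed_points d" "f \<in> homogeneous_invariants G smul \<rho> e" "0 < e" "e \<le> d"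
  shows "f v = 0"
  using assms unfolding vanishing_fixed_points_def by blast

text \<open>
  The coefficients at \<open>v\<close> of the expansion in direction \<open>w\<close> have degrees \<open>e, \<dots>, 1, 0\<close>. All but the last
  vanish by assumption on \<open>v\<close>, and the last is the constant \<open>f w\<close>, which vanishes by assumption
  on \<open>w\<close>.
\<close>

lemma invariant_at_sum_of_vanishing_fixed_points:
  assumes f: "f \<in> homogeneous_invariants G smul \<rho> e" and e: "0 < e" "e \<le> d"
    and v: "v \<in> vanishing_fixed_points d" and w: "w \<in> vanishing_fixed_points d"
  shows "f (v + w) = 0"
proof -
  have "w \<in> fixed_points G \<rho>" using w by (simp add: vanishing_fixed_points_def)
  then obtain F where F: "\<And>i. i \<le> e \<Longrightarrow> F i \<in> homogeneous_invariants G smul \<rho> (e - i)"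
    and exp: "\<And>x t. f (x + smul t w) = (\<Sum>i\<le>e. F i x * t ^ i)"
    using polarization[OF f] by metis
  have sum_eq: "f (u + w) = F e u" if "\<And>i. i < e \<Longrightarrow> F i u = 0" for u
  proof -
    have "f (u + w) = (\<Sum>i\<le>e. F i u)" using exp[of u 1] by simp
    also have "\<dots> = (\<Sum>i\<in>{e}. F i u)" by (rule sum.mono_neutral_right) (auto simp: that)
    finally show ?thesis by simp
  qed
  have "F i v = 0" if "i < e" for i
    using vanishing_fixed_pointsD[OF v F[of i]] e that by simp
  then have "f (v + w) = F e v" by (rule sum_eq)
  also have "\<dots> = F e 0"
    using F[of e] homogeneous_function_0_const[of "F e" smul v 0]
    by (simp add: homogeneous_invariant_iff)
  \<comment> \<open>the constant \<open>F e\<close> is read off by expanding \<open>f\<close> at the origin instead of \<open>v\<close>\<close>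
  also have "\<dots> = f (0 + w)"
  proof (rule sum_eq[symmetric])
    show "F i 0 = 0" if "i < e" for i
      using homogeneous_invariant_at_0[OF F[of i]] that by simp
  qed
  also have "\<dots> = 0" using vanishing_fixed_pointsD[OF w f e] by simp
  finally show ?thesis .
qed

lemma subspace_vanishing_fixed_points: "subspace (vanishing_fixed_points d)"
proof (rule subspaceI)
  show "smul c v \<in> vanishing_fixed_points d" if v: "v \<in> vanishing_fixed_points d" for c v
  proof -
    have "smul c v \<in> fixed_points G \<rho>"
      using v by (simp add: vanishing_fixed_points_def fixed_points_def action_scale)
    moreover have "f (smul c v) = 0"
      if "f \<in> homogeneous_invariants G smul \<rho> e" "0 < e" "e \<le> d" for e f
      using homogeneous_invariant_scale[OF that(1)] vanishing_fixed_pointsD[OF v that] by simp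
    ultimately show ?thesis unfolding vanishing_fixed_points_def by blast
  qed
  show "0 \<in> vanishing_fixed_points d"
  proof -
    have "0 \<in> fixed_points G \<rho>"
      using action_scale[of _ 0 0] by (simp add: fixed_points_def)
    then show ?thesis
      unfolding vanishing_fixed_points_def using homogeneous_invariant_at_0 by blast
  qed
  show "v + w \<in> vanishing_fixed_points d"
    if "v \<in> vanishing_fixed_points d" "w \<in> vanishing_fixed_points d" for v w
  proof -
    have "v + w \<in> fixed_points G \<rho>"
      using that by (simp add: vanishing_fixed_points_def fixed_points_def action_add)
    then show ?thesis
      using invariant_at_sum_of_vanishing_fixed_points[OF _ _ _ that]
      unfolding vanishing_fixed_points_def[of d] by blast
  qed
qed

text \<open>
  A decreasing chain of subspaces of a finite dimensional space is stationary from any place where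
  its dimension is minimal.
\<close>

lemma epsilon_bounded:
  "\<exists>D. \<forall>v \<in> fixed_points G \<rho> - nullcone G smul \<rho>. epsilon G smul \<rho> v \<le> enat D"
proof -
  obtain B where B: "finite_dimensional_vector_space smul B"
    using G_mod by (auto simp: G_module_def)
  let ?W = vanishing_fixed_points
  define D where "D = (ARG_MIN (\<lambda>d. dim (?W d)) d. True)"
  have min: "dim (?W D) \<le> dim (?W e)" for e
    using arg_min_nat_le[of "\<lambda>_. True" e "\<lambda>d. dim (?W d)"] by (simp add: D_def)
  have stable: "?W e = ?W D" if "D \<le> e" for e
    by (rule finite_dimensional_vector_space.subspace_dim_equal[OF B subspace_vanishing_fixed_points
          subspace_vanishing_fixed_points vanishing_fixed_points_antimono[OF that] min])
  have "epsilon G smul \<rho> v \<le> enat D"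
    if fixed: "v \<in> fixed_points G \<rho>" and nonnull: "v \<notin> nullcone G smul \<rho>" for v
  proof -
    obtain e f where e: "0 < e" and f: "f \<in> homogeneous_invariants G smul \<rho> e" "f v \<noteq> 0"
      using nonnull unfolding nullcone_def by blast
    have "v \<notin> ?W (max D e)"
      using vanishing_fixed_pointsD[OF _ f(1) e, of v "max D e"] f(2) by auto
    then have "v \<notin> ?W D" using stable[of "max D e"] by simp
    then obtain e' f' where e': "0 < e'" "e' \<le> D"
      and f': "f' \<in> homogeneous_invariants G smul \<rho> e'" "f' v \<noteq> 0"
      using fixed unfolding vanishing_fixed_points_def by blast
    have "epsilon G smul \<rho> v \<le> enat e'" by (rule epsilon_le[OF f' e'(1)])
    also have "\<dots> \<le> enat D" using e'(2) by simp
    finally show ?thesis .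
  qed
  then show ?thesis by blast
qed

lemma delta_zero_or_CHAR_power:
  "delta G smul \<rho> = 0 \<or> (\<exists>n. delta G smul \<rho> = enat (CHAR('k) ^ n))"
proof -
  define E where
    "E = {epsilon G smul \<rho> v | v. v \<in> fixed_points G \<rho> - nullcone G smul \<rho>} \<union> {0}"
  obtain D where D: "\<forall>v \<in> fixed_points G \<rho> - nullcone G smul \<rho>. epsilon G smul \<rho> v \<le> enat D"
    using epsilon_bounded by blast
  have "y \<le> enat D" if "y \<in> E" for y
    using that D by (auto simp: E_def)
  then have "finite E" by (rule finite_enat_bounded)
  moreover have "E \<noteq> {}" by (simp add: E_def)
  ultimately have "Sup E \<in> E" using Max_in[of E] by (simp add: Sup_enat_def)
  then have "delta G smul \<rho> \<in> E" by (simp add: delta_def E_def)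
  then have "delta G smul \<rho> = 0 \<or>
      (\<exists>v \<in> fixed_points G \<rho> - nullcone G smul \<rho>. delta G smul \<rho> = epsilon G smul \<rho> v)"
    unfolding E_def by blast
  then show ?thesis using epsilon_CHAR_power by (metis DiffE)
qed

end

theorem corollary1p2:
  fixes G :: "('k::field^'n^'n) set"
    and smul :: "'k \<Rightarrow> 'v::ab_group_add \<Rightarrow> 'v"
    and \<rho> :: "'k^'n^'n \<Rightarrow> 'v \<Rightarrow> 'v"
  assumes "infinite (UNIV :: 'k set)"
    and "linear_algebraic_group G"
    and "G_module G smul \<rho>"
  shows "delta G smul \<rho> = 0 \<or> delta G smul \<rho> = 1 \<or>
         (\<exists>n::nat. delta G smul \<rho> = enat (CHAR('k) ^ n))"
proof -
  interpret module_over_infinite_field G smul \<rho>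
    using assms by unfold_locales
  show ?thesis using delta_zero_or_CHAR_power by blast
qed

end
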